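(* Let $G$ be a finite group. Then $\delta(\mathcal{P}_E(G))=\kappa(\mathcal{P}_E(G))$ if and only if one of the following holds: (i) $G$ is a cyclic group; (ii) $G$ is non-cyclic and it contains a maximal cyclic subgroup of order $2$.
   Context: For a finite group $G$, the enhanced power graph $\mathcal{P}_E(G)$ is the simple undirected graph with vertex set $G$ in which two distinct vertices $x,y$ are adjacent if and only if $x,y\in\langle z\rangle$ for some $z\in G$. A maximal cyclic subgroup of $G$ is a cyclic subgroup not properly contained in any cyclic subgroup of $G$ (if $G$ is cyclic, the only one is $G$ itself). For a graph $\Gamma$, $\delta(\Gamma)$ is the minimum degree. A (vertex) cut-set of a connected graph $\Gamma$ is a set $X$ of vertices such that the subgraph $\Gamma\setminus X$ obtained by removing $X$ is either disconnected or has only one vertex; the vertex connectivity $\kappa(\Gamma)$ is the smallest cardinality of a vertex cut-set of $\Gamma$. *)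

theory Defs
  imports "HOL-Algebra.Elementary_Groups" "Graph_Theory.Digraph_Component"
begin

text \<open>Graphs are the symmetric loop-free digraphs of \<^locale>\<open>graph\<close>: each undirected edge is a
  pair of opposite arcs, so that the degree of a vertex is its out-degree.\<close>

definition min_degree :: "('a, 'b) pre_digraph \<Rightarrow> nat" where
  "min_degree H = Min (out_degree H ` verts H)"

text \<open>The library's \<^const>\<open>connected\<close> is false for the null graph, which is neither disconnected
  nor a graph with one vertex. Hence \<^term>\<open>X\<close> is required to be a proper subset of the vertices.\<close>

definition vertex_cut_set :: "('a, 'b) pre_digraph \<Rightarrow> 'a set \<Rightarrow> bool" where
  "vertex_cut_set H X \<longleftrightarrow> X \<subset> verts H \<and>
     (\<not> connected (H \<restriction> (verts H - X)) \<or> card (verts H - X) = 1)"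

definition vertex_connectivity :: "('a, 'b) pre_digraph \<Rightarrow> nat" where
  "vertex_connectivity H = Min (card ` {X. vertex_cut_set H X})"

definition enhanced_power_graph :: "('a, 'c) monoid_scheme \<Rightarrow> 'a pair_pre_digraph" where
  "enhanced_power_graph G = \<lparr> pverts = carrier G,
     parcs = {(x, y). x \<in> carrier G \<and> y \<in> carrier G \<and> x \<noteq> y \<and>
       (\<exists>z \<in> carrier G. x \<in> generate G {z} \<and> y \<in> generate G {z})} \<rparr>"

definition cyclic_subgroup :: "'a set \<Rightarrow> ('a, 'c) monoid_scheme \<Rightarrow> bool" where
  "cyclic_subgroup M G \<longleftrightarrow> subgroup M G \<and> cyclic_group (G\<lparr>carrier := M\<rparr>)"

definition maximal_cyclic_subgroup :: "'a set \<Rightarrow> ('a, 'c) monoid_scheme \<Rightarrow> bool" where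
  "maximal_cyclic_subgroup M G \<longleftrightarrow> cyclic_subgroup M G \<and> \<not> (\<exists>N. cyclic_subgroup N G \<and> M \<subset> N)"

lemma pair_graph_enhanced_power_graph:
  assumes "finite (carrier G)"
  shows "pair_graph (enhanced_power_graph G)"
proof -
  have "finite (parcs (enhanced_power_graph G))"
    by (rule finite_subset[of _ "carrier G \<times> carrier G"])
      (use assms in \<open>auto simp: enhanced_power_graph_def\<close>)
  then show ?thesis
    using assms
    by unfold_locales
      (auto simp: enhanced_power_graph_def symmetric_def arcs_ends_conv sym_def image_iff)
qed

lemma connected_enhanced_power_graph:
  fixes G :: "('a, 'c) monoid_scheme"
  assumes "group G"
  shows "connected (with_proj (enhanced_power_graph G))"
proof -
  let ?E = "parcs (mk_symmetric (with_proj (enhanced_power_graph G)))"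
  interpret group G by fact
  have e: "(x, y) \<in> ?E"
    if "x \<in> carrier G" "y \<in> carrier G" "x \<noteq> y" "x = \<one>\<^bsub>G\<^esub> \<or> y = \<one>\<^bsub>G\<^esub>" for x y
  proof -
    have "\<exists>z \<in> carrier G. x \<in> generate G {z} \<and> y \<in> generate G {z}"
      using that by (metis generate.one generate.incl insertI1)
    then show ?thesis
      using that by (force simp: mk_symmetric_def enhanced_power_graph_def)
  qed
  have *: "(x, \<one>\<^bsub>G\<^esub>) \<in> rtrancl_on (carrier G) ?E \<and> (\<one>\<^bsub>G\<^esub>, x) \<in> rtrancl_on (carrier G) ?E"
    if "x \<in> carrier G" for x
  proof (cases "x = \<one>\<^bsub>G\<^esub>")
    case False
    then show ?thesis
      using that e[of x "\<one>\<^bsub>G\<^esub>"] e[of "\<one>\<^bsub>G\<^esub>" x]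
      by (blast intro: rtrancl_on_into_rtrancl_on[OF rtrancl_on_refl])
  qed simp
  have "(x, y) \<in> rtrancl_on (carrier G) ?E" if "x \<in> carrier G" "y \<in> carrier G" for x y
    by (rule rtrancl_on_trans[of _ "\<one>\<^bsub>G\<^esub>"]) (use * that in blast)+
  moreover have "pverts (mk_symmetric (with_proj (enhanced_power_graph G))) = carrier G"
    by (simp add: mk_symmetric_def enhanced_power_graph_def)
  moreover have "\<one>\<^bsub>G\<^esub> \<in> carrier G"
    by (rule one_closed)
  ultimately show ?thesis
    unfolding connected_def strongly_connected_def reachable_def with_proj_simps arcs_ends_conv
    by auto
qed

end

theory Submission
  imports Defs "HOL-Algebra.Multiplicative_Group"
begin

text \<open>
  As for every finite undirected graph, \<open>\<kappa> \<le> \<delta>\<close>: the neighbours of a vertex of minimum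
  degree form a cut-set. The question is when this bound is attained.

  If \<open>G\<close> is cyclic, its graph is complete, a cut-set leaves a single vertex, and
  \<open>\<kappa> = \<delta>\<close>. So let \<open>G\<close> be non-cyclic. Let \<open>\<langle>z\<rangle>\<close> be a maximal cyclic subgroup. A
  cyclic subgroup that contains a generator of \<open>\<langle>z\<rangle>\<close> is \<open>\<langle>z\<rangle>\<close> itself, so the generators
  have all their neighbours inside \<open>\<langle>z\<rangle>\<close>. This has two consequences:

  \<^item> \<open>z\<close> has degree \<open>|\<langle>z\<rangle>| - 1\<close>. Since every vertex lies in some maximal cyclic subgroup, whose
    elements are pairwise adjacent, some maximal \<open>\<langle>z\<rangle>\<close> satisfies \<open>|\<langle>z\<rangle>| - 1 \<le> \<delta>\<close>.
  \<^item> Deleting \<open>\<langle>z\<rangle>\<close> except for the generators \<open>z\<close> and \<open>z\<inverse>\<close> separates these two from the elements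
    outside \<open>\<langle>z\<rangle>\<close>, which exist because \<open>G\<close> is non-cyclic. Hence
    \<open>\<kappa> \<le> |\<langle>z\<rangle>| - |{z, z\<inverse>}|\<close> for every maximal \<open>\<langle>z\<rangle>\<close>.

  If \<open>\<kappa> = \<delta>\<close>, the two bounds force \<open>z = z\<inverse>\<close>, so \<open>z\<close> has order \<open>2\<close> (order \<open>1\<close> would make
  \<open>G\<close> trivial). Conversely, if some maximal \<open>\<langle>z\<rangle>\<close> has order \<open>2\<close>, then \<open>z\<close> has degree \<open>1\<close>, while
  \<open>\<kappa> \<ge> 1\<close> because the graph is connected with more than one vertex; so
  \<open>1 \<le> \<kappa> \<le> \<delta> \<le> 1\<close>.
\<close>

section \<open>Cut-sets and vertex connectivity\<close>

text \<open>Reachability cannot leave a set that no edge crosses. It is enough to look at the arcs in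
  their given direction, because the condition on both ends is symmetric.\<close>

lemma not_connected_induce_subgraphI:
  assumes "u \<in> S" "v \<in> S" "u \<in> C" "v \<notin> C"
    and closed: "\<And>e. e \<in> arcs H \<Longrightarrow> tail H e \<in> S \<Longrightarrow> head H e \<in> S \<Longrightarrow>
      tail H e \<in> C \<longleftrightarrow> head H e \<in> C"
  shows "\<not> connected (H \<restriction> S)"
proof
  assume "connected (H \<restriction> S)"
  then have "(u, v) \<in> rtrancl_on S (parcs (mk_symmetric (H \<restriction> S)))"
    using assms by (auto simp: connected_def strongly_connected_def reachable_def)
  then have "v \<in> C"
  proof (induction rule: rtrancl_on_induct)
    case base
    show ?case by fact
  next
    case (step w w')
    then show ?case using closed by (auto simp: parcs_mk_symmetric)
  qed
  with \<open>v \<notin> C\<close> show False ..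
qed

lemma connected_induce_subgraph_complete:
  assumes "S \<noteq> {}"
    and "\<And>u v. u \<in> S \<Longrightarrow> v \<in> S \<Longrightarrow> u \<noteq> v \<Longrightarrow> \<exists>e \<in> arcs H. tail H e = u \<and> head H e = v"
  shows "connected (H \<restriction> S)"
proof -
  let ?E = "parcs (mk_symmetric (H \<restriction> S))"
  have "(u, v) \<in> rtrancl_on S ?E" if "u \<in> S" "v \<in> S" for u v
  proof (cases "u = v")
    case False
    then have "(u, v) \<in> ?E"
      using assms(2)[of u v] that by (fastforce simp: parcs_mk_symmetric)
    then show ?thesis
      using that by (blast intro: rtrancl_on_into_rtrancl_on[OF rtrancl_on_refl])
  qed (use that in simp)
  then show ?thesis
    using assms(1) by (auto simp: connected_def strongly_connected_def reachable_def)
qed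

lemma vertex_connectivity_le:
  assumes "finite (verts H)" "vertex_cut_set H X"
  shows "vertex_connectivity H \<le> card X"
proof -
  have "finite {X. vertex_cut_set H X}"
    by (rule finite_subset[of _ "Pow (verts H)"]) (use assms in \<open>auto simp: vertex_cut_set_def\<close>)
  then show ?thesis
    using assms by (auto simp: vertex_connectivity_def intro!: Min_le)
qed

text \<open>The minimum is attained: all vertices but one form a cut-set, so the minimum is over a
  nonempty set.\<close>

lemma vertex_connectivity_attained:
  assumes "finite (verts H)" "verts H \<noteq> {}"
  obtains X where "vertex_cut_set H X" "card X = vertex_connectivity H"
proof -
  obtain v where "v \<in> verts H" using assms by blast
  then have "verts H - (verts H - {v}) = {v}" by blast
  then have "vertex_cut_set H (verts H - {v})"
    using \<open>v \<in> verts H\<close> by (auto simp: vertex_cut_set_def)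
  moreover have "finite {X. vertex_cut_set H X}"
    by (rule finite_subset[of _ "Pow (verts H)"]) (use assms in \<open>auto simp: vertex_cut_set_def\<close>)
  ultimately have "vertex_connectivity H \<in> card ` {X. vertex_cut_set H X}"
    unfolding vertex_connectivity_def by (intro Min_in) auto
  then show ?thesis using that by force
qed

text \<open>The neighbours of a vertex \<open>v\<close> of minimum degree form a cut-set: without them, \<open>v\<close> is either
  isolated or the only vertex left.\<close>

lemma (in graph) vertex_connectivity_le_min_degree:
  assumes "verts G \<noteq> {}"
  shows "vertex_connectivity G \<le> min_degree G"
proof -
  have "min_degree G \<in> out_degree G ` verts G"
    unfolding min_degree_def using assms by (intro Min_in) auto
  then obtain v where v: "v \<in> verts G" "min_degree G = out_degree G v" by blast
  define X where "X = head G ` out_arcs G v"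
  have "v \<notin> X" using no_loops by (auto simp: X_def)
  have "X \<subseteq> verts G" by (auto simp: X_def)
  have "vertex_cut_set G X"
  proof (cases "verts G - X = {v}")
    case True
    then show ?thesis using v \<open>X \<subseteq> verts G\<close> by (auto simp: vertex_cut_set_def)
  next
    case False
    then obtain w where w: "w \<in> verts G - X" "w \<noteq> v" using v \<open>v \<notin> X\<close> by blast
    have "\<not> connected (G \<restriction> (verts G - X))"
    proof (rule not_connected_induce_subgraphI[where u = v and v = w and C = "{v}"])
      fix e assume e: "e \<in> arcs G" "tail G e \<in> verts G - X" "head G e \<in> verts G - X"
      have "head G e \<in> X" if "tail G e = v" using that e by (auto simp: X_def)
      moreover have "tail G e \<in> X" if "head G e = v"
      proof -
        have "(v, tail G e) \<in> arcs_ends G"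
          using e that graph_symmetric[of "tail G e" v] by (auto intro: in_arcs_imp_in_arcs_ends)
        then show ?thesis by (auto simp: X_def arcs_ends_conv)
      qed
      ultimately show "tail G e \<in> {v} \<longleftrightarrow> head G e \<in> {v}" using e by auto
    qed (use v w \<open>v \<notin> X\<close> in auto)
    then show ?thesis using v \<open>v \<notin> X\<close> \<open>X \<subseteq> verts G\<close> by (auto simp: vertex_cut_set_def)
  qed
  then have "vertex_connectivity G \<le> card X" by (intro vertex_connectivity_le) auto
  also have "\<dots> \<le> out_degree G v"
    unfolding X_def out_degree_def by (intro card_image_le) auto
  finally show ?thesis using v by simp
qed

section \<open>Maximal cyclic subgroups\<close>

context group
begin

lemma cyclic_subgroup_iff:
  "cyclic_subgroup M G \<longleftrightarrow> (\<exists>z \<in> carrier G. M = generate G {z})"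
proof
  assume M: "cyclic_subgroup M G"
  then have sub: "subgroup M G" by (simp add: cyclic_subgroup_def)
  interpret M: group "G\<lparr>carrier := M\<rparr>"
    using sub subgroup.subgroup_is_group is_group by blast
  obtain z where z: "z \<in> M" "M = range (\<lambda>n::int. z [^]\<^bsub>G\<lparr>carrier := M\<rparr>\<^esub> n)"
    using M M.cyclic_group by (auto simp: cyclic_subgroup_def)
  then have "z \<in> carrier G" using sub subgroup.mem_carrier by metis
  moreover have "M = generate G {z}"
    using z generate_pow[OF \<open>z \<in> carrier G\<close>] int_pow_consistent[OF sub \<open>z \<in> M\<close>] by auto
  ultimately show "\<exists>z \<in> carrier G. M = generate G {z}" by blast
next
  assume "\<exists>z \<in> carrier G. M = generate G {z}"
  then obtain z where z: "z \<in> carrier G" "M = generate G {z}" by blast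
  then have "subgroup M G" by (simp add: generate_is_subgroup)
  moreover have "subgroup_generated G {z} = G\<lparr>carrier := M\<rparr>"
    using z by (simp add: subgroup_generated_def)
  ultimately show "cyclic_subgroup M G"
    using cyclic_group_generated[of z] by (simp add: cyclic_subgroup_def)
qed

lemma cyclic_group_iff_generate:
  "cyclic_group G \<longleftrightarrow> (\<exists>z \<in> carrier G. generate G {z} = carrier G)"
proof -
  have "generate G {z} = range (\<lambda>n::int. z [^] n)" if "z \<in> carrier G" for z
    using generate_pow[OF that] by auto
  then show ?thesis
    unfolding cyclic_group by (metis (no_types, lifting))
qed

lemma generate_singleton_subset_iff:
  assumes "z \<in> carrier G" "w \<in> carrier G"
  shows "generate G {z} \<subseteq> generate G {w} \<longleftrightarrow> z \<in> generate G {w}"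
proof
  show "z \<in> generate G {w}" if "generate G {z} \<subseteq> generate G {w}"
    using that by (auto intro: generate.incl)
  show "generate G {z} \<subseteq> generate G {w}" if "z \<in> generate G {w}"
    using that assms by (intro generate_subgroup_incl generate_is_subgroup) auto
qed

lemma maximal_cyclic_subgroup_generate_iff:
  assumes "z \<in> carrier G"
  shows "maximal_cyclic_subgroup (generate G {z}) G \<longleftrightarrow>
    (\<forall>w \<in> carrier G. z \<in> generate G {w} \<longrightarrow> generate G {w} = generate G {z})"
proof -
  have "generate G {z} \<subset> generate G {w} \<longleftrightarrow> z \<in> generate G {w} \<and> generate G {w} \<noteq> generate G {z}"
    if "w \<in> carrier G" for w
    using generate_singleton_subset_iff[OF assms that] by auto
  then show ?thesis
    unfolding maximal_cyclic_subgroup_def cyclic_subgroup_iff using assms by blast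
qed

lemma maximal_cyclic_subgroup_imp_generate:
  assumes "maximal_cyclic_subgroup M G"
  obtains z where "z \<in> carrier G" "M = generate G {z}"
  using assms by (auto simp: maximal_cyclic_subgroup_def cyclic_subgroup_iff)

lemma in_maximal_cyclic_subgroup:
  assumes "finite (carrier G)" "v \<in> carrier G"
  obtains z where "z \<in> carrier G" "v \<in> generate G {z}"
    "maximal_cyclic_subgroup (generate G {z}) G"
proof -
  let ?A = "(\<lambda>z. generate G {z}) ` carrier G"
  obtain M where M: "M \<in> ?A" "generate G {v} \<subseteq> M" "\<forall>N \<in> ?A. M \<subseteq> N \<longrightarrow> M = N"
    using finite_has_maximal2[of ?A "generate G {v}"] assms by auto
  then obtain z where z: "z \<in> carrier G" "M = generate G {z}" by blast
  have "v \<in> generate G {z}" using M z by (auto intro: generate.incl)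
  moreover have "maximal_cyclic_subgroup (generate G {z}) G"
    using M z by (auto simp: maximal_cyclic_subgroup_def cyclic_subgroup_iff)
  ultimately show ?thesis using that z by blast
qed

text \<open>A trivial subgroup is contained in every cyclic subgroup, so it can only be maximal when
  all elements of the group are trivial.\<close>

lemma maximal_cyclic_subgroup_one_imp_cyclic_group:
  assumes "maximal_cyclic_subgroup (generate G {\<one>}) G"
  shows "cyclic_group G"
proof -
  have "w \<in> generate G {\<one>}" if "w \<in> carrier G" for w
    using assms that maximal_cyclic_subgroup_generate_iff[of \<one>]
    by (metis generate.incl generate.one one_closed singletonI)
  then have "generate G {\<one>} = carrier G"
    using generate_incl[of "{\<one>}"] by auto
  then show ?thesis using cyclic_group_iff_generate by blast
qed

lemma card_generate_involution:
  assumes "z \<in> carrier G" "z \<noteq> \<one>" "inv z = z"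
  shows "card (generate G {z}) = 2"
proof -
  have "z [^] (2::nat) = \<one>"
    using assms r_inv[of z] by (simp add: numeral_2_eq_2)
  then have "ord z dvd 2" using assms pow_eq_id by blast
  moreover have "ord z \<noteq> 1" using assms ord_eq_1 by blast
  ultimately have "ord z = 2"
    using dvd_imp_le[of "ord z" 2] by (cases "ord z = 0") auto
  then show ?thesis using generate_pow_card assms by metis
qed

section \<open>Degrees and cut-sets in the enhanced power graph\<close>

lemma (in -) pverts_enhanced_power_graph [simp]: "pverts (enhanced_power_graph G) = carrier G"
  by (simp add: enhanced_power_graph_def)

lemma out_degree_enhanced_power_graph:
  assumes "x \<in> carrier G"
  shows "out_degree (with_proj (enhanced_power_graph G)) x =
    card {y \<in> carrier G. y \<noteq> x \<and> (\<exists>z \<in> carrier G. x \<in> generate G {z} \<and> y \<in> generate G {z})}"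
    (is "_ = card ?N")
proof -
  have "out_arcs (with_proj (enhanced_power_graph G)) x = Pair x ` ?N"
    using assms by (auto simp: out_arcs_def enhanced_power_graph_def image_iff)
  then show ?thesis
    by (simp add: out_degree_def card_image inj_on_def)
qed

text \<open>The elements of a cyclic subgroup are pairwise adjacent.\<close>

lemma out_degree_ge_card_cyclic_subgroup:
  assumes "finite (carrier G)" "z \<in> carrier G" "v \<in> generate G {z}"
  shows "card (generate G {z}) - 1 \<le> out_degree (with_proj (enhanced_power_graph G)) v"
proof -
  have sub: "generate G {z} \<subseteq> carrier G" using assms generate_incl by simp
  then have "card (generate G {z}) - 1 = card (generate G {z} - {v})"
    using assms by simp
  also have "\<dots> \<le> out_degree (with_proj (enhanced_power_graph G)) v"
    unfolding out_degree_enhanced_power_graph[OF subsetD[OF sub assms(3)]]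
    using assms sub by (intro card_mono) auto
  finally show ?thesis .
qed

lemma out_degree_maximal_cyclic_generator:
  assumes "z \<in> carrier G" "maximal_cyclic_subgroup (generate G {z}) G"
  shows "out_degree (with_proj (enhanced_power_graph G)) z = card (generate G {z}) - 1"
proof -
  have "{y \<in> carrier G. y \<noteq> z \<and> (\<exists>w \<in> carrier G. z \<in> generate G {w} \<and> y \<in> generate G {w})} =
      generate G {z} - {z}"
    using assms maximal_cyclic_subgroup_generate_iff generate_incl[of "{z}"]
    by (auto intro: generate.incl)
  then show ?thesis
    using assms by (simp add: out_degree_enhanced_power_graph generate.incl)
qed

text \<open>Both \<open>z\<close> and \<open>inv z\<close> generate \<open>\<langle>z\<rangle>\<close>, so by maximality all their neighbours lie in \<open>\<langle>z\<rangle>\<close>. Once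
  the rest of \<open>\<langle>z\<rangle>\<close> is deleted, they are cut off from the elements outside \<open>\<langle>z\<rangle>\<close>.\<close>

lemma vertex_connectivity_le_maximal_cyclic:
  assumes "finite (carrier G)" "\<not> cyclic_group G"
    and z: "z \<in> carrier G" "maximal_cyclic_subgroup (generate G {z}) G"
  shows "vertex_connectivity (with_proj (enhanced_power_graph G)) \<le>
    card (generate G {z}) - card {z, inv z}"
proof -
  let ?H = "with_proj (enhanced_power_graph G)"
  let ?C = "{z, inv z}"
  let ?X = "generate G {z} - ?C"
  have C: "?C \<subseteq> generate G {z}" by (auto intro: generate.incl generate.inv)
  have sub: "generate G {z} \<subseteq> carrier G" using z generate_incl by simp
  have nbr: "y \<in> generate G {z}"
    if "c \<in> ?C" "w \<in> carrier G" "c \<in> generate G {w}" "y \<in> generate G {w}" for c w y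
  proof -
    have "subgroup (generate G {w}) G" using that by (simp add: generate_is_subgroup)
    then have "z \<in> generate G {w}"
      using that z subgroup.m_inv_closed[of _ G "inv z"] by auto
    then show ?thesis
      using that z maximal_cyclic_subgroup_generate_iff by auto
  qed
  obtain u where u: "u \<in> carrier G" "u \<notin> generate G {z}"
    using assms(2) z sub cyclic_group_iff_generate by blast
  have "\<not> connected (?H \<restriction> (carrier G - ?X))"
  proof (rule not_connected_induce_subgraphI[where u = z and v = u and C = ?C])
    fix e
    assume e: "e \<in> arcs ?H" "tail ?H e \<in> carrier G - ?X" "head ?H e \<in> carrier G - ?X"
    then obtain w where w: "w \<in> carrier G" "tail ?H e \<in> generate G {w}" "head ?H e \<in> generate G {w}"
      by (auto simp: enhanced_power_graph_def)
    show "tail ?H e \<in> ?C \<longleftrightarrow> head ?H e \<in> ?C"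
      using nbr[OF _ w] nbr[OF _ w(1,3,2)] e(2,3) by blast
  qed (use z u C in auto)
  moreover have "?X \<subset> carrier G" using sub u by blast
  ultimately have "vertex_cut_set ?H ?X"
    by (simp add: vertex_cut_set_def)
  then have "vertex_connectivity ?H \<le> card ?X"
    using assms(1) by (intro vertex_connectivity_le) simp_all
  then show ?thesis
    using C by (simp add: card_Diff_subset)
qed

text \<open>The graph is connected, so the empty set is not a cut-set.\<close>

lemma vertex_connectivity_pos:
  assumes "finite (carrier G)" "card (carrier G) \<noteq> 1"
  shows "0 < vertex_connectivity (with_proj (enhanced_power_graph G))"
proof -
  let ?H = "with_proj (enhanced_power_graph G)"
  obtain X where X: "vertex_cut_set ?H X" "card X = vertex_connectivity ?H"
    using vertex_connectivity_attained[of ?H] assms by auto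
  have "?H \<restriction> carrier G = ?H"
    by (auto simp: induce_subgraph_def enhanced_power_graph_def with_proj_def)
  then have "X \<noteq> {}"
    using X connected_enhanced_power_graph[OF is_group] assms
    by (auto simp: vertex_cut_set_def)
  moreover have "finite X"
    using X assms finite_subset by (auto simp: vertex_cut_set_def)
  ultimately show ?thesis using X card_gt_0_iff by metis
qed

text \<open>The graph of a cyclic group is complete, so what a cut-set leaves is connected and hence must
  be a single vertex.\<close>

lemma min_degree_le_vertex_connectivity_cyclic:
  assumes "finite (carrier G)" "cyclic_group G"
  shows "min_degree (with_proj (enhanced_power_graph G)) \<le>
    vertex_connectivity (with_proj (enhanced_power_graph G))"
proof -
  let ?H = "with_proj (enhanced_power_graph G)"
  obtain z where z: "z \<in> carrier G" "generate G {z} = carrier G"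
    using assms cyclic_group_iff_generate by blast
  obtain X where X: "vertex_cut_set ?H X" "card X = vertex_connectivity ?H"
    using vertex_connectivity_attained[of ?H] assms by auto
  then have sub: "X \<subset> carrier G" by (simp add: vertex_cut_set_def)
  have "connected (?H \<restriction> (carrier G - X))"
  proof (rule connected_induce_subgraph_complete)
    fix u v assume "u \<in> carrier G - X" "v \<in> carrier G - X" "u \<noteq> v"
    then have "(u, v) \<in> arcs ?H" using z by (auto simp: enhanced_power_graph_def)
    then show "\<exists>e \<in> arcs ?H. tail ?H e = u \<and> head ?H e = v" by force
  qed (use sub in blast)
  then have "card (carrier G - X) = 1" using X by (auto simp: vertex_cut_set_def)
  moreover have "finite X" using sub assms finite_subset by blast
  ultimately have "card (carrier G) - 1 = card X"
    using sub by (simp add: card_Diff_subset)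
  moreover have "min_degree ?H \<le> out_degree ?H \<one>"
    unfolding min_degree_def using assms by (intro Min_le) auto
  moreover have "out_degree ?H \<one> \<le> card (carrier G - {\<one>})"
    unfolding out_degree_enhanced_power_graph[OF one_closed]
    using assms by (intro card_mono) auto
  ultimately show ?thesis using X by simp
qed

end

section \<open>When minimum degree and vertex connectivity agree\<close>

theorem theorem3p2:
  fixes G :: "('a, 'c) monoid_scheme"
  assumes "group G" and "finite (carrier G)"
  shows "min_degree (with_proj (enhanced_power_graph G)) =
           vertex_connectivity (with_proj (enhanced_power_graph G)) \<longleftrightarrow>
         cyclic_group G \<or>
         (\<not> cyclic_group G \<and> (\<exists>M. maximal_cyclic_subgroup M G \<and> card M = 2))"
proof -
  let ?H = "with_proj (enhanced_power_graph G)"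
  interpret group G by fact
  interpret P: pair_graph "enhanced_power_graph G"
    using assms pair_graph_enhanced_power_graph by blast
  have le: "vertex_connectivity ?H \<le> min_degree ?H"
    using P.vertex_connectivity_le_min_degree by auto
  show ?thesis
  proof (cases "cyclic_group G")
    case True
    then show ?thesis
      using le min_degree_le_vertex_connectivity_cyclic assms by (simp add: le_antisym)
  next
    case noncyclic: False
    have "min_degree ?H = vertex_connectivity ?H \<longleftrightarrow>
        (\<exists>M. maximal_cyclic_subgroup M G \<and> card M = 2)"
    proof
      assume eq: "min_degree ?H = vertex_connectivity ?H"
      have "min_degree ?H \<in> out_degree ?H ` carrier G"
        unfolding min_degree_def with_proj_simps pverts_enhanced_power_graph
        using assms by (intro Min_in) auto
      then obtain v where v: "v \<in> carrier G" "min_degree ?H = out_degree ?H v" by blast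
      obtain z where z: "z \<in> carrier G" "v \<in> generate G {z}"
        "maximal_cyclic_subgroup (generate G {z}) G"
        using in_maximal_cyclic_subgroup assms v by blast
      have "card (generate G {z}) - 1 \<le> card (generate G {z}) - card {z, inv\<^bsub>G\<^esub> z}"
        using out_degree_ge_card_cyclic_subgroup[OF assms(2) z(1,2)] v eq
          vertex_connectivity_le_maximal_cyclic[OF assms(2) noncyclic z(1,3)] by linarith
      moreover have "card {z, inv\<^bsub>G\<^esub> z} \<le> card (generate G {z})"
        using z assms finite_subset[OF generate_incl[of "{z}"]]
        by (intro card_mono) (auto intro: generate.incl generate.inv)
      \<comment> \<open>If \<open>z\<close> and its inverse were distinct, the right-hand side would be \<open>|\<langle>z\<rangle>| - 2\<close>.\<close>
      ultimately have "inv\<^bsub>G\<^esub> z = z"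
        by (cases "inv\<^bsub>G\<^esub> z = z") auto
      moreover have "z \<noteq> \<one>\<^bsub>G\<^esub>"
        using z noncyclic maximal_cyclic_subgroup_one_imp_cyclic_group by blast
      ultimately show "\<exists>M. maximal_cyclic_subgroup M G \<and> card M = 2"
        using z card_generate_involution by blast
    next
      assume "\<exists>M. maximal_cyclic_subgroup M G \<and> card M = 2"
      then obtain z where z: "z \<in> carrier G" "maximal_cyclic_subgroup (generate G {z}) G"
        "card (generate G {z}) = 2"
        using maximal_cyclic_subgroup_imp_generate by metis
      have "card (carrier G) \<noteq> 1"
        using card_mono[OF assms(2) generate_incl[of "{z}"]] z by simp
      then have "0 < vertex_connectivity ?H"
        using vertex_connectivity_pos assms by blast
      moreover have "min_degree ?H \<le> out_degree ?H z"
        unfolding min_degree_def using assms z by (intro Min_le) auto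
      ultimately show "min_degree ?H = vertex_connectivity ?H"
        using le out_degree_maximal_cyclic_generator[OF z(1,2)] z by simp
    qed
    then show ?thesis using noncyclic by blast
  qed
qed

end
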